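(* Let $W : \mathbb{R} \to \mathbb{R}$ be given by $W(x) = \cos x$ if $|x| \leq \pi/2$ and $W(x) = 0$ otherwise. Let $p \geq 2$ be an integer. Given arbitrary reals $x_1 < \cdots < x_p$ and $y_1 < \cdots < y_p$, there exists $m_0 \in (0,\infty)$ such that, for every real $\alpha \geq 0$, the matrices \[ \bigl( W(m(x_j - y_k))^\alpha \bigr)_{j,k=1}^p, \qquad 0 < m < m_0, \] are each $\mathrm{TP}$ if $\alpha > p-2$, are each $\mathrm{TN}$ if $\alpha \in \{0, 1, \ldots, p-2\}$, and each have a negative principal minor if $\alpha \in (0, p-2) \setminus \mathbb{Z}$.
   Context: A real matrix is $\mathrm{TP}$ (respectively $\mathrm{TN}$) if all of its minors (determinants of square submatrices with rows and columns in increasing order) are positive (respectively non-negative). *)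

theory Defs
  imports
    Complex_Main
    "Jordan_Normal_Form.Determinant"
    "Jordan_Normal_Form.DL_Submatrix"
begin

definition W :: "real \<Rightarrow> real" where
  "W x = (if \<bar>x\<bar> \<le> pi / 2 then cos x else 0)"

(* submatrix A I J lists the rows in I and the columns in J in increasing order.
   Nonempty index sets exclude the empty minor, which equals 1. *)

definition minors :: "real mat \<Rightarrow> real set" where
  "minors A = {det (submatrix A I J) | I J.
     I \<subseteq> {..<dim_row A} \<and> J \<subseteq> {..<dim_col A} \<and> card I = card J \<and> I \<noteq> {}}"

definition principal_minors :: "real mat \<Rightarrow> real set" where
  "principal_minors A = {det (submatrix A I I) | I.
     I \<subseteq> {..<dim_row A} \<and> I \<subseteq> {..<dim_col A} \<and> I \<noteq> {}}"

definition TP :: "real mat \<Rightarrow> bool" where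
  "TP A \<longleftrightarrow> (\<forall>d \<in> minors A. d > 0)"

definition TN :: "real mat \<Rightarrow> bool" where
  "TN A \<longleftrightarrow> (\<forall>d \<in> minors A. d \<ge> 0)"

(* With 0 powr 0 = 0, a zero value of W gives a zero entry for every \<alpha>, including \<alpha> = 0. *)

definition W_mat :: "nat \<Rightarrow> (nat \<Rightarrow> real) \<Rightarrow> (nat \<Rightarrow> real) \<Rightarrow> real \<Rightarrow> real \<Rightarrow> real mat" where
  "W_mat p x y m \<alpha> = mat p p (\<lambda>(j, k). W (m * (x j - y k)) powr \<alpha>)"

end

theory Submission
  imports Defs
begin

text \<open>Write \<open>D\<^sub>n(\<alpha>)\<close> for the determinant of \<open>cos (x\<^sub>j - y\<^sub>k) powr \<alpha>\<close>, all differences being less than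
  \<open>pi / 2\<close> in absolute value. Dividing row \<open>j\<close> by \<open>cos (x\<^sub>j - y\<^sub>0) powr \<alpha>\<close> makes the first column
  constant; taking differences of consecutive rows and applying the mean value theorem in each
  row replaces the entries by derivatives of \<open>(cos (s - y\<^sub>k) / cos (s - y\<^sub>0)) powr \<alpha>\<close>, which are
  \<open>\<alpha>\<close> times \<open>cos (s - y\<^sub>k) powr (\<alpha> - 1)\<close> up to positive row and column factors, since the sine
  addition formula gives \<open>(cos (s - b) / cos (s - a))' = sin (b - a) / cos\<^sup>2 (s - a)\<close>. Hence
  \<open>D\<^sub>n(\<alpha>)\<close> has the sign of \<open>\<alpha> ^ (n - 1)\<close> times that of \<open>D\<^sub>n\<^sub>-\<^sub>1(\<alpha> - 1)\<close>, so by induction the sign of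
  the product of the \<open>(\<alpha> - i) ^ (n - 1 - i)\<close>. All three claims are read off from this sign.\<close>

section \<open>Determinant identities and a mean value theorem for rows\<close>

lemma det_scale_rows_cols:
  fixes f :: "nat \<Rightarrow> nat \<Rightarrow> 'a :: comm_ring_1"
  shows "det (mat n n (\<lambda>(i, j). a i * b j * f i j)) =
    (\<Prod>i<n. a i) * (\<Prod>j<n. b j) * det (mat n n (\<lambda>(i, j). f i j))"
proof -
  have "signof p * (\<Prod>i = 0..<n. mat n n (\<lambda>(i, j). a i * b j * f i j) $$ (i, p i)) =
     (\<Prod>i<n. a i) * (\<Prod>j<n. b j) *
       (signof p * (\<Prod>i = 0..<n. mat n n (\<lambda>(i, j). f i j) $$ (i, p i)))"
    if p: "p permutes {0..<n}" for p
  proof -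
    have bound: "p i < n" if "i < n" for i
      using permutes_in_image[OF p, of i] that by simp
    have b: "(\<Prod>i = 0..<n. b (p i)) = (\<Prod>j = 0..<n. b j)"
      using prod.permute[OF p, of b] by (simp add: o_def)
    show ?thesis
      by (simp add: bound prod.distrib b atLeast0LessThan[symmetric] mult_ac)
  qed
  then show ?thesis
    by (simp add: det_def'[of _ n] sum_distrib_left)
qed

text \<open>The cofactors along row \<open>m\<close> do not see that row, so varying it gives a
  linear form with fixed coefficients. This is what lets a one-variable theorem act on a single
  row.\<close>

lemma det_row_update:
  fixes h :: "nat \<Rightarrow> nat \<Rightarrow> 'a :: comm_ring_1"
  assumes "m < n"
  shows "det (mat n n (\<lambda>(i, j). if i = m then r j else h i j)) =
    (\<Sum>j<n. r j * cofactor (mat n n (\<lambda>(i, j). h i j)) m j)"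
proof -
  let ?A = "mat n n (\<lambda>(i, j). if i = m then r j else h i j)"
  have "cofactor ?A m j = cofactor (mat n n (\<lambda>(i, j). h i j)) m j" if "j < n" for j
    unfolding cofactor_def mat_delete_def
    by (rule arg_cong[where f = "\<lambda>B. _ * det B"], rule eq_matI) auto
  then show ?thesis
    using laplace_expansion_row[of ?A n m] assms by simp
qed

lemma det_first_col_ones:
  fixes f :: "nat \<Rightarrow> nat \<Rightarrow> 'a :: comm_ring_1"
  shows "det (mat (Suc n) (Suc n) (\<lambda>(i, j). if j = 0 then 1 else f i (j - 1))) =
    det (mat n n (\<lambda>(i, j). f (Suc i) j - f i j))"
proof -
  let ?A = "mat (Suc n) (Suc n) (\<lambda>(i, j). if j = 0 then 1 else f i (j - 1))"
  let ?L = "mat (Suc n) (Suc n) (\<lambda>(i, j). if i = j then 1 else if i = Suc j then - 1 else 0) :: 'a mat"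
  let ?B = "mat (Suc n) (Suc n) (\<lambda>(i, j). if i = 0 then ?A $$ (0, j) else ?A $$ (i, j) - ?A $$ (i - 1, j))"
  have LA: "?L * ?A = ?B"
  proof (rule eq_matI)
    fix i j assume "i < dim_row ?B" "j < dim_col ?B"
    then have i: "i < Suc n" and j: "j < Suc n" by auto
    have "(?L * ?A) $$ (i, j) = (\<Sum>k = 0..<Suc n. ?L $$ (i, k) * ?A $$ (k, j))"
      using i j by (simp add: scalar_prod_def del: sum.op_ivl_Suc)
    \<comment> \<open>Writing the subdiagonal condition as \<open>Suc k = i\<close> rather than
      \<open>k = i - 1\<close> makes the second sum vanish for \<open>i = 0\<close>, where
      subtraction on naturals would be truncated.\<close>
    also have "\<dots> = (\<Sum>k = 0..<Suc n. (if k = i then ?A $$ (k, j) else 0) -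
        (if Suc k = i then ?A $$ (k, j) else 0))"
      by (rule sum.cong) (use i j in auto)
    also have "\<dots> = (\<Sum>k = 0..<Suc n. if k = i then ?A $$ (k, j) else 0) -
        (\<Sum>k = 0..<Suc n. if Suc k = i then ?A $$ (k, j) else 0)"
      by (rule sum_subtractf)
    also have "(\<Sum>k = 0..<Suc n. if k = i then ?A $$ (k, j) else 0) = ?A $$ (i, j)"
      using i by (simp add: sum.delta del: sum.op_ivl_Suc index_mat)
    also have "(\<Sum>k = 0..<Suc n. if Suc k = i then ?A $$ (k, j) else 0) =
        (if i = 0 then 0 else ?A $$ (i - 1, j))"
    proof (cases i)
      case (Suc l)
      then show ?thesis
        using i by (simp add: sum.delta del: sum.op_ivl_Suc index_mat)
    qed simp
    finally show "(?L * ?A) $$ (i, j) = ?B $$ (i, j)"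
      using i j by simp
  qed auto
  have "det ?L = prod_list (diag_mat ?L)"
    by (rule det_lower_triangular[of "Suc n"]) auto
  also have "diag_mat ?L = replicate (Suc n) 1"
    by (rule nth_equalityI) (auto simp: diag_mat_def simp del: upt_Suc replicate_Suc)
  finally have "det ?L = 1"
    by simp
  then have "det ?A = det ?B"
    using det_mult[of ?L "Suc n" ?A] LA by simp
  also have "\<dots> = (\<Sum>i<Suc n. ?B $$ (i, 0) * cofactor ?B i 0)"
    by (rule laplace_expansion_column) auto
  also have "\<dots> = cofactor ?B 0 0"
    by (subst sum.lessThan_Suc_shift) simp
  also have "\<dots> = det (mat_delete ?B 0 0)"
    by (simp add: cofactor_def)
  also have "mat_delete ?B 0 0 = mat n n (\<lambda>(i, j). f (Suc i) j - f i j)"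
    by (rule eq_matI) (auto simp: mat_delete_def)
  finally show ?thesis .
qed

text \<open>Applied entry by entry, the mean value theorem would give a different point in each
  column. Applied to the cofactor expansion along a row, it gives one point for the entire row; the
  rows are treated one after another.\<close>

lemma det_mvt_rows:
  fixes g g' :: "nat \<Rightarrow> real \<Rightarrow> real"
  assumes incr: "\<And>i. i < n \<Longrightarrow> x i < x (Suc i)"
    and deriv: "\<And>i j s. i < n \<Longrightarrow> j < n \<Longrightarrow> x i \<le> s \<Longrightarrow> s \<le> x (Suc i) \<Longrightarrow>
      (g j has_real_derivative g' j s) (at s)"
  obtains t where "\<And>i. i < n \<Longrightarrow> x i < t i \<and> t i < x (Suc i)"
    and "det (mat n n (\<lambda>(i, j). g j (x (Suc i)) - g j (x i))) =
      (\<Prod>i<n. x (Suc i) - x i) * det (mat n n (\<lambda>(i, j). g' j (t i)))"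
proof -
  let ?d = "\<lambda>i j. g j (x (Suc i)) - g j (x i)"
  \<comment> \<open>Here \<open>m\<close> counts the rows already turned into derivatives; the
    remaining rows are still differences.\<close>
  have "\<exists>t. (\<forall>i<m. x i < t i \<and> t i < x (Suc i)) \<and>
     det (mat n n (\<lambda>(i, j). ?d i j)) =
     (\<Prod>i<m. x (Suc i) - x i) * det (mat n n (\<lambda>(i, j). if i < m then g' j (t i) else ?d i j))"
    if "m \<le> n" for m
    using that
  proof (induction m)
    case 0
    then show ?case by simp
  next
    case (Suc m)
    then have m: "m < n" by simp
    obtain t where t: "\<forall>i<m. x i < t i \<and> t i < x (Suc i)"
      and det: "det (mat n n (\<lambda>(i, j). ?d i j)) = (\<Prod>i<m. x (Suc i) - x i) *
        det (mat n n (\<lambda>(i, j). if i < m then g' j (t i) else ?d i j))"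
      using Suc by auto
    define h where "h i j = (if i < m then g' j (t i) else ?d i j)" for i j
    define C where "C j = cofactor (mat n n (\<lambda>(i, j). h i j)) m j" for j
    \<comment> \<open>The mean value theorem is used for the scalar function
      \<open>\<Sum>j<n. g j s * C j\<close> of \<open>s\<close>; the cofactors \<open>C j\<close>
      are constants.\<close>
    have "\<exists>s. x m < s \<and> s < x (Suc m) \<and>
        (\<Sum>j<n. g j (x (Suc m)) * C j) - (\<Sum>j<n. g j (x m) * C j) =
        (x (Suc m) - x m) * (\<Sum>j<n. g' j s * C j)"
      by (rule MVT2[OF incr[OF m]]) (auto intro!: derivative_eq_intros deriv[OF m])
    then obtain s where s: "x m < s" "s < x (Suc m)"
      and mvt: "(\<Sum>j<n. ?d m j * C j) = (x (Suc m) - x m) * (\<Sum>j<n. g' j s * C j)"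
      by (auto simp: left_diff_distrib sum_subtractf)
    have "mat n n (\<lambda>(i, j). h i j) = mat n n (\<lambda>(i, j). if i = m then ?d m j else h i j)"
      by (rule cong_mat) (auto simp: h_def)
    then have "det (mat n n (\<lambda>(i, j). h i j)) = (\<Sum>j<n. ?d m j * C j)"
      using det_row_update[OF m, of "?d m" h] by (simp add: C_def)
    also have "\<dots> = (x (Suc m) - x m) * det (mat n n (\<lambda>(i, j). if i = m then g' j s else h i j))"
      using det_row_update[OF m, of "\<lambda>j. g' j s" h] mvt by (simp add: C_def)
    also have "mat n n (\<lambda>(i, j). if i = m then g' j s else h i j) =
        mat n n (\<lambda>(i, j). if i < Suc m then g' j ((t(m := s)) i) else ?d i j)"
      by (rule cong_mat) (auto simp: h_def)
    finally have "det (mat n n (\<lambda>(i, j). ?d i j)) = (\<Prod>i<Suc m. x (Suc i) - x i) *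
        det (mat n n (\<lambda>(i, j). if i < Suc m then g' j ((t(m := s)) i) else ?d i j))"
      using det by (simp add: h_def mult.assoc)
    then show ?case
      using t s by (intro exI[of _ "t(m := s)"]) (auto simp: less_Suc_eq)
  qed
  from this[OF order_refl] obtain t where t: "\<forall>i<n. x i < t i \<and> t i < x (Suc i)"
    and "det (mat n n (\<lambda>(i, j). ?d i j)) = (\<Prod>i<n. x (Suc i) - x i) *
       det (mat n n (\<lambda>(i, j). if i < n then g' j (t i) else ?d i j))"
    by auto
  moreover have "mat n n (\<lambda>(i, j). if i < n then g' j (t i) else ?d i j) =
      mat n n (\<lambda>(i, j). g' j (t i))"
    by (rule cong_mat) auto
  ultimately show ?thesis
    using that by auto
qed

section \<open>Sign of the determinant of powers of cosines\<close>

text \<open>The derivative is arranged as a factor in \<open>s\<close> and \<open>a\<close>, a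
  factor in \<open>a\<close> and \<open>b\<close>, and the kernel with exponent
  \<open>\<alpha> - 1\<close>. With \<open>a\<close> fixed, the first two become row and column
  scalings.\<close>

lemma has_real_derivative_cos_ratio_powr:
  fixes a b s \<alpha> :: real
  assumes "cos (s - a) > 0" and "cos (s - b) > 0"
  shows "((\<lambda>s. (cos (s - b) / cos (s - a)) powr \<alpha>) has_real_derivative
    (\<alpha> * cos (s - a) powr (- \<alpha> - 1)) * sin (b - a) * cos (s - b) powr (\<alpha> - 1)) (at s)"
proof -
  have "sin (b - a) = cos (s - b) * sin (s - a) - sin (s - b) * cos (s - a)"
    using sin_diff[of "s - a" "s - b"] by (simp add: algebra_simps)
  then have ratio: "((\<lambda>s. cos (s - b) / cos (s - a)) has_real_derivative
      sin (b - a) / (cos (s - a))\<^sup>2) (at s)"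
    using assms by (auto intro!: derivative_eq_intros simp: power2_eq_square)
  have "cos (s - a) powr (\<alpha> - 1) * (cos (s - a))\<^sup>2 * cos (s - a) powr (- \<alpha> - 1) = 1"
    using assms by (simp flip: powr_numeral powr_add)
  then have inv: "cos (s - a) powr (- \<alpha> - 1) = 1 / (cos (s - a) powr (\<alpha> - 1) * (cos (s - a))\<^sup>2)"
    using assms by (simp add: field_simps)
  show ?thesis
    by (rule DERIV_cong[OF DERIV_fun_powr[OF ratio]]) (use assms in \<open>simp_all add: inv powr_divide\<close>)
qed

lemma cos_gt_zero_abs: "\<bar>s\<bar> < pi / 2 \<Longrightarrow> cos s > 0"
  by (rule cos_gt_zero_pi) auto

lemma sgn_prod: "sgn (\<Prod>i\<in>A. f i) = (\<Prod>i\<in>A. sgn (f i :: 'a :: linordered_idom))"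
  by (induction A rule: infinite_finite_induct) (simp_all add: sgn_mult)

text \<open>Each reduction lowers both the size and the exponent by one, so \<alpha> must be allowed
  to become negative. The last factor has exponent 0 and equals 1 even if
  \<open>\<alpha> = n - 1\<close>.\<close>

lemma sgn_det_cos_powr:
  fixes x y :: "nat \<Rightarrow> real" and \<alpha> :: real
  assumes "strict_mono_on {..<n} x" and "strict_mono_on {..<n} y"
    and "\<And>j k. j < n \<Longrightarrow> k < n \<Longrightarrow> \<bar>x j - y k\<bar> < pi / 2"
  shows "sgn (det (mat n n (\<lambda>(j, k). cos (x j - y k) powr \<alpha>))) =
    (\<Prod>i<n. sgn (\<alpha> - real i) ^ (n - 1 - i))"
  using assms
proof (induction n arbitrary: x y \<alpha>)
  case 0
  then show ?case by (simp add: det_dim_zero)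
next
  case (Suc n)
  note x = Suc.prems(1) and y = Suc.prems(2) and close = Suc.prems(3)
  have incr: "x i < x (Suc i)" if "i < n" for i
    using that by (intro strict_mono_onD[OF x]) auto
  \<comment> \<open>The bound is convex in \<open>s\<close>, so it passes from two consecutive nodes
    to the points between them.\<close>
  have near: "\<bar>s - y k\<bar> < pi / 2" if "i < n" "k < Suc n" "x i \<le> s" "s \<le> x (Suc i)" for i k s
  proof -
    have "\<bar>x i - y k\<bar> < pi / 2" "\<bar>x (Suc i) - y k\<bar> < pi / 2"
      using close that by auto
    then show ?thesis
      using that by linarith
  qed
  define g where "g k s = (cos (s - y (Suc k)) / cos (s - y 0)) powr \<alpha>" for k s
  define r where "r s = \<alpha> * cos (s - y 0) powr (- \<alpha> - 1)" for s
  define c where "c k = sin (y (Suc k) - y 0)" for k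
  define g' where "g' k s = r s * c k * cos (s - y (Suc k)) powr (\<alpha> - 1)" for k s
  have "(g k has_real_derivative g' k s) (at s)"
    if "i < n" "k < n" "x i \<le> s" "s \<le> x (Suc i)" for i k s
    unfolding g_def g'_def r_def c_def
    by (rule has_real_derivative_cos_ratio_powr) (use near that in \<open>auto intro!: cos_gt_zero_abs\<close>)
  then obtain t where t: "\<And>i. i < n \<Longrightarrow> x i < t i \<and> t i < x (Suc i)"
    and mvt: "det (mat n n (\<lambda>(i, j). g j (x (Suc i)) - g j (x i))) =
      (\<Prod>i<n. x (Suc i) - x i) * det (mat n n (\<lambda>(i, j). g' j (t i)))"
    using det_mvt_rows[of n x g g'] incr by blast
  have "strict_mono_on {..<n} t"
  proof (rule strict_mono_onI)
    fix i j assume ij: "i \<in> {..<n}" "j \<in> {..<n}" "i < j"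
    have "x (Suc i) \<le> x j"
      using ij by (intro strict_mono_on_leD[OF x]) auto
    then show "t i < t j"
      using t[of i] t[of j] ij by auto
  qed
  moreover have "strict_mono_on {..<n} (\<lambda>k. y (Suc k))"
    by (rule strict_mono_onI) (auto intro!: strict_mono_onD[OF y])
  moreover have "\<bar>t j - y (Suc k)\<bar> < pi / 2" if "j < n" "k < n" for j k
    using near[of j "Suc k" "t j"] t[of j] that by auto
  ultimately have IH: "sgn (det (mat n n (\<lambda>(j, k). cos (t j - y (Suc k)) powr (\<alpha> - 1)))) =
      (\<Prod>i<n. sgn (\<alpha> - 1 - real i) ^ (n - 1 - i))"
    by (rule Suc.IH)
  have c: "sgn (c k) = 1" if "k < n" for k
  proof -
    have "0 < y (Suc k) - y 0"
      using strict_mono_onD[OF y, of 0 "Suc k"] that by simp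
    \<comment> \<open>Both points lie within \<open>pi / 2\<close> of \<open>x 0\<close>.\<close>
    moreover have "y (Suc k) - y 0 < pi"
    proof -
      have "\<bar>x 0 - y 0\<bar> < pi / 2" "\<bar>x 0 - y (Suc k)\<bar> < pi / 2"
        using close that by auto
      then show ?thesis
        by linarith
    qed
    ultimately show ?thesis
      unfolding c_def by (simp add: sin_gt_zero)
  qed
  have r: "sgn (r (t i)) = sgn \<alpha>" if "i < n" for i
  proof -
    have "\<bar>t i - y 0\<bar> < pi / 2"
      using near[of i 0 "t i"] t[of i] that by auto
    then show ?thesis
      using cos_gt_zero_abs[of "t i - y 0"] by (simp add: r_def sgn_mult)
  qed
  have pos: "cos (x j - y k) > 0" if "j < Suc n" "k < Suc n" for j k
    using close[OF that] by (rule cos_gt_zero_abs)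
  have "mat (Suc n) (Suc n) (\<lambda>(j, k). cos (x j - y k) powr \<alpha>) =
      mat (Suc n) (Suc n) (\<lambda>(j, k). cos (x j - y 0) powr \<alpha> * 1 *
        (if k = 0 then 1 else g (k - 1) (x j)))"
    by (rule cong_mat) (auto simp: g_def powr_divide dest: pos[THEN less_imp_le] pos)
  then have "det (mat (Suc n) (Suc n) (\<lambda>(j, k). cos (x j - y k) powr \<alpha>)) =
      (\<Prod>j<Suc n. cos (x j - y 0) powr \<alpha>) *
      det (mat n n (\<lambda>(i, j). g j (x (Suc i)) - g j (x i)))"
    using det_scale_rows_cols[of "Suc n" "\<lambda>j. cos (x j - y 0) powr \<alpha>" "\<lambda>_. 1"]
      det_first_col_ones[of n "\<lambda>j k. g k (x j)"] by simp
  also have "det (mat n n (\<lambda>(i, j). g j (x (Suc i)) - g j (x i))) =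
      (\<Prod>i<n. x (Suc i) - x i) * ((\<Prod>i<n. r (t i)) * (\<Prod>k<n. c k) *
        det (mat n n (\<lambda>(j, k). cos (t j - y (Suc k)) powr (\<alpha> - 1))))"
    unfolding mvt g'_def by (subst det_scale_rows_cols) simp
  finally have "sgn (det (mat (Suc n) (Suc n) (\<lambda>(j, k). cos (x j - y k) powr \<alpha>))) =
      (\<Prod>j<Suc n. sgn (cos (x j - y 0) powr \<alpha>)) * ((\<Prod>i<n. sgn (x (Suc i) - x i)) *
       ((\<Prod>i<n. sgn (r (t i))) * (\<Prod>k<n. sgn (c k)) *
         (\<Prod>i<n. sgn (\<alpha> - 1 - real i) ^ (n - 1 - i))))"
    by (simp only: sgn_mult sgn_prod IH)
  also have "(\<Prod>j<Suc n. sgn (cos (x j - y 0) powr \<alpha>)) = 1"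
  proof (rule prod.neutral, rule ballI)
    fix j assume "j \<in> {..<Suc n}"
    then show "sgn (cos (x j - y 0) powr \<alpha>) = 1"
      using pos[of j 0] by simp
  qed
  also have "(\<Prod>i<n. sgn (x (Suc i) - x i)) = 1"
    by (rule prod.neutral) (auto simp: incr)
  also have "(\<Prod>k<n. sgn (c k)) = 1"
    by (rule prod.neutral) (auto simp: c)
  also have "(\<Prod>i<n. sgn (r (t i))) = sgn \<alpha> ^ n"
    by (simp add: r)
  \<comment> \<open>\<open>sgn \<alpha> ^ n\<close> is the factor of index 0; the factors from the
    induction hypothesis are those of index \<open>Suc i\<close>.\<close>
  finally show ?case
    by (simp add: prod.lessThan_Suc_shift diff_diff_eq add.commute del: prod.lessThan_Suc)
qed

section \<open>Minors of \<open>W_mat\<close> and the three ranges of the exponent\<close>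

text \<open>Picking rows and columns in increasing order and scaling by \<open>m > 0\<close> keeps
  the nodes increasing, and \<open>close\<close> keeps \<open>W\<close> on its cosine branch. Hence
  the sign of a minor depends only on its size and \<alpha>.\<close>

lemma sgn_det_submatrix_W_mat:
  assumes "strict_mono_on {..<p} x" and "strict_mono_on {..<p} y"
    and "m > 0"
    and close: "\<And>j k. j < p \<Longrightarrow> k < p \<Longrightarrow> \<bar>m * (x j - y k)\<bar> < pi / 2"
    and I: "I \<subseteq> {..<p}" and J: "J \<subseteq> {..<p}" and card: "card I = card J"
  shows "sgn (det (submatrix (W_mat p x y m \<alpha>) I J)) =
    (\<Prod>i<card I. sgn (\<alpha> - real i) ^ (card I - 1 - i))"
proof -
  define n where "n = card I"
  have dims: "{i. i < p \<and> i \<in> I} = I" "{i. i < p \<and> i \<in> J} = J"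
    using I J by auto
  have mono: "strict_mono_on {..<n} (\<lambda>i. m * z (pick K i))"
    if "strict_mono_on {..<p} z" "K \<subseteq> {..<p}" "card K = n" for z :: "nat \<Rightarrow> real" and K
  proof (rule strict_mono_onI)
    fix i j assume ij: "i \<in> {..<n}" "j \<in> {..<n}" "i < j"
    have "pick K i \<in> K" "pick K j \<in> K"
      using ij that by (auto intro!: pick_in_set_le)
    moreover have "pick K i < pick K j"
      using ij that by (intro pick_mono_le) auto
    ultimately have "z (pick K i) < z (pick K j)"
      using that by (intro strict_mono_onD[OF that(1)]) auto
    then show "m * z (pick K i) < m * z (pick K j)"
      using \<open>m > 0\<close> by simp
  qed
  have bound: "pick I j < p" "pick J j < p" if "j < n" for j
    using pick_in_set_le[of j I] pick_in_set_le[of j J] I J card that by (auto simp: n_def)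
  have near: "\<bar>m * x (pick I j) - m * y (pick J k)\<bar> < pi / 2" if "j < n" "k < n" for j k
    using close[OF bound(1)[OF that(1)] bound(2)[OF that(2)]] by (simp add: right_diff_distrib)
  have "submatrix (W_mat p x y m \<alpha>) I J =
      mat n n (\<lambda>(j, k). cos (m * x (pick I j) - m * y (pick J k)) powr \<alpha>)"
  proof (rule eq_matI)
    fix j k
    assume "j < dim_row (mat n n (\<lambda>(j, k). cos (m * x (pick I j) - m * y (pick J k)) powr \<alpha>))"
      "k < dim_col (mat n n (\<lambda>(j, k). cos (m * x (pick I j) - m * y (pick J k)) powr \<alpha>))"
    then have jk: "j < n" "k < n" by auto
    then have "submatrix (W_mat p x y m \<alpha>) I J $$ (j, k) = W_mat p x y m \<alpha> $$ (pick I j, pick J k)"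
      by (intro submatrix_index) (simp_all add: W_mat_def dims n_def card)
    then show "submatrix (W_mat p x y m \<alpha>) I J $$ (j, k) =
        mat n n (\<lambda>(j, k). cos (m * x (pick I j) - m * y (pick J k)) powr \<alpha>) $$ (j, k)"
      using near[OF jk] jk bound by (simp add: W_mat_def W_def right_diff_distrib)
  qed (simp_all add: dim_submatrix W_mat_def dims n_def card)
  moreover have "sgn (det (mat n n (\<lambda>(j, k). cos (m * x (pick I j) - m * y (pick J k)) powr \<alpha>))) =
      (\<Prod>i<n. sgn (\<alpha> - real i) ^ (n - 1 - i))"
  proof (rule sgn_det_cos_powr)
    show "strict_mono_on {..<n} (\<lambda>j. m * x (pick I j))"
      by (rule mono[OF assms(1) I]) (simp add: n_def)
    show "strict_mono_on {..<n} (\<lambda>k. m * y (pick J k))"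
      by (rule mono[OF assms(2) J]) (simp add: n_def card)
  qed (fact near)
  ultimately show ?thesis
    by (simp only: n_def)
qed

theorem theorem3p7:
  fixes p :: nat and x y :: "nat \<Rightarrow> real"
  assumes "p \<ge> 2"
    and "strict_mono_on {..<p} x"
    and "strict_mono_on {..<p} y"
  shows "\<exists>m0 :: real. m0 > 0 \<and>
    (\<forall>\<alpha> :: real. \<alpha> \<ge> 0 \<longrightarrow> (\<forall>m :: real. 0 < m \<and> m < m0 \<longrightarrow>
      (\<alpha> > real p - 2 \<longrightarrow> TP (W_mat p x y m \<alpha>)) \<and>
      (\<alpha> \<in> real ` {0..p - 2} \<longrightarrow> TN (W_mat p x y m \<alpha>)) \<and>
      (\<alpha> \<in> {0<..<real p - 2} - \<int> \<longrightarrow> (\<exists>d \<in> principal_minors (W_mat p x y m \<alpha>). d < 0))))"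
proof -
  \<comment> \<open>\<open>S\<close> bounds every difference, so \<open>m0 = pi / 2 / S\<close> is
    small enough; the summand 1 makes positivity immediate.\<close>
  define S where "S = 1 + (\<Sum>j<p. \<Sum>k<p. \<bar>x j - y k\<bar>)"
  have S: "S > 0"
    unfolding S_def by (intro add_pos_nonneg sum_nonneg) auto
  have le_S: "\<bar>x j - y k\<bar> \<le> S" if "j < p" "k < p" for j k
  proof -
    have "\<bar>x j - y k\<bar> \<le> (\<Sum>k<p. \<bar>x j - y k\<bar>)"
      using that by (intro member_le_sum) auto
    also have "\<dots> \<le> (\<Sum>j<p. \<Sum>k<p. \<bar>x j - y k\<bar>)"
      using that by (intro member_le_sum[where f = "\<lambda>j. \<Sum>k<p. \<bar>x j - y k\<bar>"]) (auto intro: sum_nonneg)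
    finally show ?thesis
      by (simp add: S_def)
  qed
  have main: "(\<alpha> > real p - 2 \<longrightarrow> TP (W_mat p x y m \<alpha>)) \<and>
      (\<alpha> \<in> real ` {0..p - 2} \<longrightarrow> TN (W_mat p x y m \<alpha>)) \<and>
      (\<alpha> \<in> {0<..<real p - 2} - \<int> \<longrightarrow> (\<exists>d \<in> principal_minors (W_mat p x y m \<alpha>). d < 0))"
    if \<alpha>: "\<alpha> \<ge> 0" and m: "0 < m" "m < pi / 2 / S" for \<alpha> m
  proof -
    have close: "\<bar>m * (x j - y k)\<bar> < pi / 2" if "j < p" "k < p" for j k
    proof -
      have "\<bar>m * (x j - y k)\<bar> \<le> m * S"
        using le_S[OF that] m by (simp add: abs_mult)
      also have "\<dots> < pi / 2"
        using m(2) S by (simp add: pos_less_divide_eq)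
      finally show ?thesis .
    qed
    note sgn_det = sgn_det_submatrix_W_mat[OF assms(2,3) m(1) close]
    have minor: "\<exists>n \<le> p. sgn d = (\<Prod>i<n. sgn (\<alpha> - real i) ^ (n - 1 - i))"
      if d_minor: "d \<in> minors (W_mat p x y m \<alpha>)" for d
    proof -
      obtain I J where d: "d = det (submatrix (W_mat p x y m \<alpha>) I J)"
        and IJ: "I \<subseteq> {..<p}" "J \<subseteq> {..<p}" "card I = card J"
        using d_minor by (auto simp: minors_def W_mat_def)
      have "card I \<le> p"
        using card_mono[OF _ IJ(1)] by simp
      then show ?thesis
        using sgn_det[OF _ _ IJ, of \<alpha>] d by blast
    qed
    have "TP (W_mat p x y m \<alpha>)" if big: "\<alpha> > real p - 2"
      unfolding TP_def
    proof
      fix d assume "d \<in> minors (W_mat p x y m \<alpha>)"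
      then obtain n where n: "n \<le> p" and d: "sgn d = (\<Prod>i<n. sgn (\<alpha> - real i) ^ (n - 1 - i))"
        using minor by blast
      have "(\<Prod>i<n. sgn (\<alpha> - real i) ^ (n - 1 - i)) = 1"
      proof (rule prod.neutral, rule ballI)
        fix i assume i: "i \<in> {..<n}"
        show "sgn (\<alpha> - real i) ^ (n - 1 - i) = 1"
        \<comment> \<open>For \<open>i = n - 1\<close> the exponent is 0. Every other index is at
          most \<open>p - 2\<close>, which explains the threshold for \<alpha>.\<close>
        proof (cases "i = n - 1")
          case False
          then have "i + 2 \<le> p"
            using i n by simp
          then have "\<alpha> > real i"
            using big by linarith
          then show ?thesis by simp
        qed simp
      qed
      then show "d > 0"
        using d by (simp add: sgn_1_pos)
    qed
    moreover have "TN (W_mat p x y m \<alpha>)" if int: "\<alpha> \<in> real ` {0..p - 2}"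
      unfolding TN_def
    proof
      fix d assume "d \<in> minors (W_mat p x y m \<alpha>)"
      then obtain n where d: "sgn d = (\<Prod>i<n. sgn (\<alpha> - real i) ^ (n - 1 - i))"
        using minor by blast
      obtain a where a: "\<alpha> = real a"
        using int by auto
      have "(\<Prod>i<n. sgn (\<alpha> - real i) ^ (n - 1 - i)) \<ge> 0"
      \<comment> \<open>If \<open>a + 1 < n\<close>, the factor of index \<open>a\<close> is 0 with
        a positive exponent. Otherwise no index exceeds \<open>a\<close>, so no factor is
        negative.\<close>
      proof (cases "a + 1 < n")
        case True
        then have "(\<Prod>i<n. sgn (\<alpha> - real i) ^ (n - 1 - i)) = 0"
          by (intro prod_zero) (auto simp: a intro!: bexI[of _ a])
        then show ?thesis by (simp only: order_refl)
      next
        case False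
        then show ?thesis
          by (intro prod_nonneg) (auto simp: a)
      qed
      then show "d \<ge> 0"
        using d by (metis zero_le_sgn_iff)
    qed
    moreover have "\<exists>d \<in> principal_minors (W_mat p x y m \<alpha>). d < 0"
      if nonint: "\<alpha> \<in> {0<..<real p - 2} - \<int>"
    proof -
      \<comment> \<open>In the leading principal minor of size \<open>q + 3\<close>, the factors up
        to index \<open>q\<close> are 1, index \<open>q + 1\<close> has a negative base with
        exponent 1, and index \<open>q + 2\<close> has exponent 0. So the sign is -1.\<close>
      define q where "q = nat \<lfloor>\<alpha>\<rfloor>"
      have "real q \<noteq> \<alpha>"
        using nonint by auto
      moreover have "real q \<le> \<alpha>" "\<alpha> < real q + 1"
        using \<alpha> by (auto simp: q_def)
      ultimately have q: "real q < \<alpha>" "\<alpha> < real q + 1"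
        by auto
      then have qp: "q + 3 \<le> p"
        using nonint by auto
      have "(\<Prod>i<q + 3. sgn (\<alpha> - real i) ^ (q + 3 - 1 - i)) =
          (\<Prod>i<q + 1. sgn (\<alpha> - real i) ^ (q + 2 - i)) * sgn (\<alpha> - real (q + 1))"
        by (simp add: numeral_eq_Suc)
      also have "(\<Prod>i<q + 1. sgn (\<alpha> - real i) ^ (q + 2 - i)) = 1"
        by (rule prod.neutral) (use q in auto)
      also have "sgn (\<alpha> - real (q + 1)) = - 1"
        using q by simp
      finally have "det (submatrix (W_mat p x y m \<alpha>) {..<q + 3} {..<q + 3}) < 0"
        using sgn_det[of "{..<q + 3}" "{..<q + 3}" \<alpha>] qp by (auto simp: sgn_1_neg)
      moreover have "det (submatrix (W_mat p x y m \<alpha>) {..<q + 3} {..<q + 3}) \<in>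
          principal_minors (W_mat p x y m \<alpha>)"
        unfolding principal_minors_def using qp
        by (auto intro!: exI[of _ "{..<q + 3}"] simp: W_mat_def lessThan_empty_iff)
      ultimately show ?thesis by blast
    qed
    ultimately show ?thesis by blast
  qed
  show ?thesis
    by (rule exI[of _ "pi / 2 / S"]) (use S main in auto)
qed

end
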